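(* Let $n\ge 3$ be an integer and let $G=D_{2n}$ be the dihedral group of order $2n$. Then the Harborth constant $\mathsf{g}(G)$ of $G$ is $$\mathsf{g}(G)=\begin{cases} n+2 & \text{if } 2\mid n,\\ 2n+1 & \text{otherwise.}\end{cases}$$
   Context: The dihedral group of order $2n$ is $D_{2n}=\langle x,y \mid x^2=y^n=(xy)^2=1\rangle$. For a finite group $G$ (written multiplicatively, not necessarily abelian), $\exp(G)$ denotes the exponent of $G$, i.e. the least positive integer $m$ with $g^m=1$ for all $g\in G$. A finite sequence $(x_1,\ldots,x_k)$ of elements of $G$ is a one-product sequence if there is a permutation $\pi$ of $\{1,\ldots,k\}$ such that $x_{\pi(1)}x_{\pi(2)}\cdots x_{\pi(k)}=1$. A subset $A\subseteq G$ admits a one-product subsequence of length $m$ if there is a subset $B\subseteq A$ with $|B|=m$ whose (pairwise distinct) elements can be arranged in some order so that their product equals $1$. The Harborth constant $\mathsf{g}(G)$ is the smallest integer $k$ such that every subset $A\subseteq G$ with $|A|=k$ admits a one-product subsequence of length $\exp(G)$; if there is no such $k\le |G|$, then by convention $\mathsf{g}(G)=|G|+1$. *)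

theory Defs
  imports "HOL-Algebra.Coset"
begin

text \<open>Groups given by generators and relators. A word over generators of type \<open>'g\<close> is a list of
  letters, where \<open>(a, True)\<close> stands for \<open>a\<close> and \<open>(a, False)\<close> for its formal inverse. The group
  consists of the words modulo the least congruence that makes the letters invertible and
  the relators trivial.\<close>

type_synonym 'g word = "('g \<times> bool) list"

inductive word_eq :: "'g word set \<Rightarrow> 'g word \<Rightarrow> 'g word \<Rightarrow> bool" for R where
  refl: "word_eq R u u"
| sym: "word_eq R u v \<Longrightarrow> word_eq R v u"
| trans: "word_eq R u v \<Longrightarrow> word_eq R v w \<Longrightarrow> word_eq R u w"
| append: "word_eq R u u' \<Longrightarrow> word_eq R v v' \<Longrightarrow> word_eq R (u @ v) (u' @ v')"
| cancel: "word_eq R [(a, b), (a, \<not> b)] []"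
| relator: "r \<in> R \<Longrightarrow> word_eq R r []"

definition presented_group :: "'g word set \<Rightarrow> 'g word set monoid" where
  "presented_group R =
    \<lparr> carrier = UNIV // {(u, v). word_eq R u v},
      monoid.mult = (\<lambda>A B. {w. \<exists>u\<in>A. \<exists>v\<in>B. word_eq R (u @ v) w}),
      one = {w. word_eq R [] w} \<rparr>"

datatype dihedral_gen = gen_x | gen_y

definition dihedral_relators :: "nat \<Rightarrow> dihedral_gen word set" where
  "dihedral_relators n =
    (let x = [(gen_x, True)]; y = [(gen_y, True)]
     in {x @ x, concat (replicate n y), (x @ y) @ (x @ y)})"

text \<open>The dihedral group of order \<open>2 * n\<close>; the parameter is \<open>n\<close>, not the order.\<close>

definition dihedral_group :: "nat \<Rightarrow> dihedral_gen word set monoid" where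
  "dihedral_group n = presented_group (dihedral_relators n)"

definition group_exp :: "('a, 'b) monoid_scheme \<Rightarrow> nat" where
  "group_exp G = (LEAST m. 0 < m \<and> (\<forall>g\<in>carrier G. g [^]\<^bsub>G\<^esub> m = \<one>\<^bsub>G\<^esub>))"

definition admits_one_product :: "('a, 'b) monoid_scheme \<Rightarrow> 'a set \<Rightarrow> nat \<Rightarrow> bool" where
  "admits_one_product G A m \<longleftrightarrow>
    (\<exists>B\<subseteq>A. finite B \<and> card B = m \<and>
      (\<exists>xs. distinct xs \<and> set xs = B \<and> foldr (\<otimes>\<^bsub>G\<^esub>) xs \<one>\<^bsub>G\<^esub> = \<one>\<^bsub>G\<^esub>))"

definition harborth_property :: "('a, 'b) monoid_scheme \<Rightarrow> nat \<Rightarrow> bool" where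
  "harborth_property G k \<longleftrightarrow>
    (\<forall>A\<subseteq>carrier G. card A = k \<longrightarrow> admits_one_product G A (group_exp G))"

text \<open>Intended for finite groups only: \<open>order\<close> and \<open>card\<close> are 0 on infinite sets.\<close>

definition harborth :: "('a, 'b) monoid_scheme \<Rightarrow> nat" where
  "harborth G =
    (if \<exists>k\<le>order G. harborth_property G k then LEAST k. harborth_property G k
     else order G + 1)"


lemma equiv_word_eq: "equiv UNIV {(u, v). word_eq R u v}"
  by (auto intro!: equivI reflI symI transI intro: word_eq.intros)

lemma word_class_eq_iff:
  "{w. word_eq R u w} = {w. word_eq R v w} \<longleftrightarrow> word_eq R u v"
  by (auto intro: word_eq.intros)

lemma carrier_presented_group:
  "carrier (presented_group R) = range (\<lambda>u. {w. word_eq R u w})"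
  by (auto simp: presented_group_def quotient_def)

lemma one_presented_group: "\<one>\<^bsub>presented_group R\<^esub> = {w. word_eq R [] w}"
  by (simp add: presented_group_def)

lemma mult_presented_group:
  "{w. word_eq R u w} \<otimes>\<^bsub>presented_group R\<^esub> {w. word_eq R v w} = {w. word_eq R (u @ v) w}"
  unfolding presented_group_def
  by (auto intro: word_eq.intros)

lemma word_eq_inverse:
  "word_eq R (map (\<lambda>(a, b). (a, \<not> b)) (rev u) @ u) []"
proof (induction u)
  case Nil
  show ?case by (simp add: word_eq.refl)
next
  case (Cons l u)
  obtain a b where l: "l = (a, b)" by force
  let ?u = "map (\<lambda>(a, b). (a, \<not> b)) (rev u)"
  have "word_eq R [(a, \<not> b), (a, b)] []"
    using word_eq.cancel[of R a "\<not> b"] by simp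
  then have "word_eq R (?u @ ([(a, \<not> b), (a, b)] @ u)) (?u @ ([] @ u))"
    by (intro word_eq.append word_eq.refl)
  then show ?case
    using Cons.IH l by (auto intro: word_eq.trans)
qed

lemma group_presented_group: "group (presented_group R)"
proof (rule groupI)
  fix A assume "A \<in> carrier (presented_group R)"
  then obtain u where "A = {w. word_eq R u w}"
    by (auto simp: carrier_presented_group)
  then have "{w. word_eq R (map (\<lambda>(a, b). (a, \<not> b)) (rev u)) w} \<otimes>\<^bsub>presented_group R\<^esub> A
      = \<one>\<^bsub>presented_group R\<^esub>"
    by (simp add: mult_presented_group one_presented_group word_class_eq_iff word_eq_inverse)
  then show "\<exists>B\<in>carrier (presented_group R). B \<otimes>\<^bsub>presented_group R\<^esub> A = \<one>\<^bsub>presented_group R\<^esub>"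
    by (auto simp: carrier_presented_group)
qed (auto simp: carrier_presented_group mult_presented_group one_presented_group)


text \<open>The group defined by the presentation indeed has order \<open>2 * n\<close>. Words act on the integers
  by affine maps \<open>k \<mapsto> s * k + t\<close>, with \<open>x\<close> acting as \<open>k \<mapsto> - k\<close> and \<open>y\<close> as \<open>k \<mapsto> k + 1\<close>; the pair
  of \<open>s\<close> and \<open>t mod n\<close> is an invariant separating the normal forms \<open>x ^ a * y ^ b\<close>.\<close>

fun sgn_part :: "dihedral_gen word \<Rightarrow> int" where
  "sgn_part [] = 1"
| "sgn_part ((gen_x, _) # w) = - sgn_part w"
| "sgn_part ((gen_y, _) # w) = sgn_part w"

fun shift_part :: "dihedral_gen word \<Rightarrow> int" where
  "shift_part [] = 0"
| "shift_part ((gen_x, _) # w) = - shift_part w"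
| "shift_part ((gen_y, b) # w) = shift_part w + (if b then 1 else -1)"

lemma sgn_part_append: "sgn_part (u @ v) = sgn_part u * sgn_part v"
  by (induction u rule: sgn_part.induct) auto

lemma shift_part_append: "shift_part (u @ v) = sgn_part u * shift_part v + shift_part u"
  by (induction u rule: shift_part.induct) auto

lemma concat_replicate_singleton: "concat (replicate n [a]) = replicate n a"
  by (induction n) auto

lemma sgn_shift_part_y:
  "sgn_part (replicate b (gen_y, True)) = 1" "shift_part (replicate b (gen_y, True)) = int b"
  by (induction b) auto

lemma word_eq_dihedral_invariant:
  assumes "word_eq (dihedral_relators n) u v"
  shows "sgn_part u = sgn_part v \<and> int n dvd shift_part u - shift_part v"
  using assms
proof induction
  case (sym u v)
  then show ?case by (simp add: dvd_diff_commute)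
next
  case (trans u v w)
  then show ?case using dvd_add[of "int n" "shift_part u - shift_part v"] by fastforce
next
  case (append u u' v v')
  have "shift_part (u @ v) - shift_part (u' @ v') =
      sgn_part u' * (shift_part v - shift_part v') + (shift_part u - shift_part u')"
    using append.IH by (simp add: shift_part_append algebra_simps)
  with append.IH show ?case
    by (simp add: sgn_part_append)
next
  case (cancel a b)
  then show ?case by (cases a) auto
next
  case (relator r)
  then show ?case
    by (auto simp: dihedral_relators_def Let_def concat_replicate_singleton sgn_shift_part_y)
qed simp

lemma dihedral_normal_form:
  assumes n: "n > 0"
  shows "\<exists>a<2. \<exists>b<n. word_eq (dihedral_relators n) u
           (replicate a (gen_x, True) @ replicate b (gen_y, True))"
proof -
  define R where "R = dihedral_relators n"
  define x where "x = (gen_x, True)"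
  define y where "y = (gen_y, True)"
  define S where
    "S = {u. \<exists>a<2. \<exists>b<n. word_eq R u (replicate a x @ replicate b y)}"
  have xx: "word_eq R [x, x] []" and yn: "word_eq R (replicate n y) []"
    and xyxy: "word_eq R [x, y, x, y] []"
    by (auto intro!: word_eq.relator
        simp: R_def dihedral_relators_def Let_def concat_replicate_singleton x_def y_def)
  have S_I: "replicate a x @ replicate b y \<in> S" if "a < 2" "b < n" for a b
    using that unfolding S_def by (blast intro: word_eq.refl)
  have S_eq: "u \<in> S" if "word_eq R u v" "v \<in> S" for u v
    using that unfolding S_def by (blast intro: word_eq.trans)
  have x_S: "x # u \<in> S" if "u \<in> S" for u
  proof -
    obtain a b where ab: "a < 2" "b < n" "word_eq R u (replicate a x @ replicate b y)"
      using \<open>u \<in> S\<close> by (auto simp: S_def)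
    have 1: "word_eq R (x # u) (x # replicate a x @ replicate b y)"
      using word_eq.append[OF word_eq.refl[of R "[x]"] ab(3)] by simp
    consider "a = 0" | "a = 1" using ab(1) by linarith
    then have "x # replicate a x @ replicate b y \<in> S"
    proof cases
      case 1
      with ab(2) S_I[of 1 b] show ?thesis by simp
    next
      case 2
      have "word_eq R ([x, x] @ replicate b y) ([] @ replicate b y)"
        by (intro word_eq.append xx word_eq.refl)
      moreover have "replicate b y \<in> S" using S_I[of 0 b] ab(2) by simp
      ultimately show ?thesis using 2 by (auto intro: S_eq)
    qed
    with 1 show ?thesis by (rule S_eq)
  qed
  have y_S0: "replicate b y \<in> S" for b
  proof (induction b rule: less_induct)
    case (less b)
    show ?case
    proof (cases "b < n")
      case True
      then show ?thesis using S_I[of 0 b] by simp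
    next
      case False
      then have "word_eq R (replicate n y @ replicate (b - n) y) ([] @ replicate (b - n) y)"
        by (intro word_eq.append yn word_eq.refl)
      moreover have "replicate n y @ replicate (b - n) y = replicate b y"
        using False by (simp add: replicate_add[symmetric])
      ultimately show ?thesis using less.IH[of "b - n"] n False by (auto intro: S_eq)
    qed
  qed
  have yx: "word_eq R [y, x] (x # replicate (n - 1) y)"
  proof -
    have "word_eq R ([] @ [y, x] @ []) (([x, x] @ [y, x]) @ replicate n y)"
      using word_eq.append[OF word_eq.append[OF xx word_eq.refl[of R "[y, x]"]] yn]
      by (auto intro: word_eq.sym)
    also have "([x, x] @ [y, x]) @ replicate n y = [x] @ [x, y, x, y] @ replicate (n - 1) y"
      using n by (cases n) auto
    finally have 1: "word_eq R [y, x] ([x] @ [x, y, x, y] @ replicate (n - 1) y)"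
      by simp
    have "word_eq R ([x] @ [x, y, x, y] @ replicate (n - 1) y) ([x] @ [] @ replicate (n - 1) y)"
      by (intro word_eq.append xyxy word_eq.refl)
    with 1 show ?thesis by (auto intro: word_eq.trans)
  qed
  have y_S: "y # u \<in> S" if "u \<in> S" for u
  proof -
    obtain a b where ab: "a < 2" "b < n" "word_eq R u (replicate a x @ replicate b y)"
      using \<open>u \<in> S\<close> by (auto simp: S_def)
    have 1: "word_eq R (y # u) (y # replicate a x @ replicate b y)"
      using word_eq.append[OF word_eq.refl[of R "[y]"] ab(3)] by simp
    consider "a = 0" | "a = 1" using ab(1) by linarith
    then have "y # replicate a x @ replicate b y \<in> S"
    proof cases
      case 1
      then show ?thesis using y_S0[of "Suc b"] by simp
    next
      case 2
      have "word_eq R ([y, x] @ replicate b y) ((x # replicate (n - 1) y) @ replicate b y)"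
        by (intro word_eq.append yx word_eq.refl)
      then have "word_eq R (y # x # replicate b y) (x # replicate (n - 1 + b) y)"
        by (simp add: replicate_add)
      with 2 show ?thesis using x_S[OF y_S0] by (auto intro: S_eq)
    qed
    with 1 show ?thesis by (rule S_eq)
  qed
  have inv_x: "word_eq R [(gen_x, False)] [x]"
  proof -
    have "word_eq R ([(gen_x, False)] @ [x, x]) ([(gen_x, False)] @ [])"
      by (intro word_eq.append xx word_eq.refl)
    moreover have "word_eq R ([(gen_x, False), x] @ [x]) ([] @ [x])"
      using word_eq.cancel[of R gen_x False]
      by (intro word_eq.append word_eq.refl) (simp add: x_def)
    ultimately show ?thesis by (auto intro: word_eq.sym word_eq.trans)
  qed
  have inv_y: "word_eq R [(gen_y, False)] (replicate (n - 1) y)"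
  proof -
    have "word_eq R ([(gen_y, False)] @ replicate n y) ([(gen_y, False)] @ [])"
      by (intro word_eq.append yn word_eq.refl)
    moreover have "word_eq R ([(gen_y, False), y] @ replicate (n - 1) y) ([] @ replicate (n - 1) y)"
      using word_eq.cancel[of R gen_y False]
      by (intro word_eq.append word_eq.refl) (simp add: y_def)
    moreover have "[(gen_y, False)] @ replicate n y = [(gen_y, False), y] @ replicate (n - 1) y"
      using n by (cases n) auto
    ultimately show ?thesis by (auto intro: word_eq.sym word_eq.trans)
  qed
  have ys_S: "replicate k y @ u \<in> S" if "u \<in> S" for k u
    using that by (induction k) (auto intro: y_S)
  have "u \<in> S" for u
  proof (induction u)
    case Nil
    show ?case using y_S0[of 0] by simp
  next
    case (Cons l u)
    obtain g b where l: "l = (g, b)" by force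
    have letter: "l # u \<in> S" if "word_eq R [l] v" "v @ u \<in> S" for v
      using word_eq.append[OF that(1) word_eq.refl[of R u]] that(2) by (auto intro: S_eq)
    show ?case
    proof (cases g; cases b)
      assume "g = gen_x" "b" then show ?thesis using l x_S[OF Cons.IH] by (simp add: x_def)
    next
      assume "g = gen_x" "\<not> b" then show ?thesis using l letter inv_x x_S[OF Cons.IH] by simp
    next
      assume "g = gen_y" "b" then show ?thesis using l y_S[OF Cons.IH] by (simp add: y_def)
    next
      assume "g = gen_y" "\<not> b"
      then show ?thesis using l letter inv_y ys_S[OF Cons.IH] by simp
    qed
  qed
  then show ?thesis unfolding S_def R_def x_def y_def by blast
qed

lemma order_dihedral_group:
  assumes n: "n > 0"
  shows "order (dihedral_group n) = 2 * n"
proof -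
  define f where "f = (\<lambda>(a, b). {w. word_eq (dihedral_relators n)
    (replicate a (gen_x, True) @ replicate b (gen_y, True)) w})"
  have "inj_on f ({..<2} \<times> {..<n})"
  proof (rule inj_onI, clarify)
    fix a b a' b' :: nat
    assume ab: "a < 2" "b < n" "a' < 2" "b' < n" and eq: "f (a, b) = f (a', b')"
    have "word_eq (dihedral_relators n) (replicate a (gen_x, True) @ replicate b (gen_y, True))
        (replicate a' (gen_x, True) @ replicate b' (gen_y, True))"
      using eq by (simp add: f_def word_class_eq_iff)
    then have *: "sgn_part (replicate a (gen_x, True)) = sgn_part (replicate a' (gen_x, True))"
      "int n dvd sgn_part (replicate a (gen_x, True)) * int b + shift_part (replicate a (gen_x, True))
        - (sgn_part (replicate a' (gen_x, True)) * int b' + shift_part (replicate a' (gen_x, True)))"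
      by (auto dest!: word_eq_dihedral_invariant
          simp: sgn_part_append shift_part_append sgn_shift_part_y)
    have "a = 0 \<or> a = 1" "a' = 0 \<or> a' = 1" using ab by auto
    with * have "a = a'" "int n dvd int b - int b'"
      by (auto simp: dvd_diff_commute)
    moreover from this ab have "b = b'"
      using zdvd_imp_le[of "int n" "int b - int b'"] zdvd_imp_le[of "int n" "int b' - int b"]
      by (cases b b' rule: linorder_cases) (auto simp: dvd_diff_commute)
    ultimately show "a = a' \<and> b = b'" by simp
  qed
  moreover have "f ` ({..<2} \<times> {..<n}) = carrier (dihedral_group n)"
  proof
    show "f ` ({..<2} \<times> {..<n}) \<subseteq> carrier (dihedral_group n)"
      by (auto simp: f_def dihedral_group_def carrier_presented_group)
  next
    show "carrier (dihedral_group n) \<subseteq> f ` ({..<2} \<times> {..<n})"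
    proof
      fix A assume "A \<in> carrier (dihedral_group n)"
      then obtain u where u: "A = {w. word_eq (dihedral_relators n) u w}"
        by (auto simp: dihedral_group_def carrier_presented_group)
      obtain a b where "a < 2" "b < n" "word_eq (dihedral_relators n) u
          (replicate a (gen_x, True) @ replicate b (gen_y, True))"
        using dihedral_normal_form[OF n] by blast
      then have "A = f (a, b)" "(a, b) \<in> {..<2} \<times> {..<n}"
        by (auto simp: u f_def word_class_eq_iff)
      then show "A \<in> f ` ({..<2} \<times> {..<n})" by blast
    qed
  qed
  ultimately show ?thesis
    unfolding order_def by (metis card_image card_cartesian_product card_lessThan)
qed

end

theory Submission
  imports Defs
begin

text \<open>Write \<open>rot a\<close> for \<open>y ^ a\<close> and \<open>ref a\<close> for \<open>x * y ^ a\<close>. The exponent of the group is \<open>n\<close> for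
  even \<open>n\<close> and \<open>2 * n\<close> for odd \<open>n\<close>.

  For odd \<open>n\<close> a one-product subsequence of length \<open>2 * n\<close> would have to use the whole group; but
  the product of all elements contains an odd number of reflections, so it is a reflection.

  Let \<open>n = 2 * m\<close>. All rotations together with one reflection form a set of size \<open>n + 1\<close> without a
  one-product subset of size \<open>n\<close>: such a subset cannot contain the single reflection, and the
  product of all rotations is \<open>rot m\<close>.

  Now take \<open>n + 2\<close> elements. Moving a rotation past a reflection inverts it. So if a subset has an even
  positive number of reflections, the exponents that its products can reach include the signed sums in
  which each rotation gets an arbitrary sign and the reflections are paired off, a pair
  \<open>ref a, ref b\<close> contributing \<open>b - a\<close> or \<open>a - b\<close> (lemma \<open>arrangement_exists\<close>). Modulo 2 the signs are
  irrelevant, so two elements are dropped in such a way that the number of reflections and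
  the sum of the exponents become even; the signs can then be chosen to make the sum
  vanish modulo \<open>n\<close> as soon as the subset sums of the rotation exponents and the pair differences
  cover the integers modulo \<open>m\<close>.

  By lemma \<open>subset_sums_cover\<close> this happens if, for each divisor \<open>k > 1\<close> of \<open>m\<close>, at least \<open>k - 1\<close> of these
  numbers are not divisible by \<open>k\<close>. There are at most \<open>n / k\<close> rotation exponents divisible by \<open>k\<close>. For the
  reflections, sort the exponents cyclically and pair neighbours: the gaps add up to at most \<open>n\<close>, and one that is
  divisible by \<open>k\<close> is at least \<open>k\<close>, so there are few such gaps. Combining both bounds gives enough numbers
  for all \<open>k \<ge> 3\<close> except \<open>k = m = 3\<close> (lemma \<open>enough_outside\<close>). There are two ways to pair cyclic
  neighbours, and choosing the better one settles \<open>m = 3\<close>, and \<open>k = 2\<close> provided that not all rotation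
  exponents are even with all reflection exponents of one parity; the two dropped elements are
  chosen to avoid this degenerate configuration as well (lemma \<open>deletion_counts\<close>).\<close>

section \<open>Subset sums in cyclic groups\<close>

text \<open>The subset sums of a family grow by at least one residue with each member that does not
  stabilise the set reached so far. Take a subfamily \<open>T\<close>, maximal under inclusion, with more than
  \<open>card T\<close> subset sums. The set of its sums is then invariant under all unused members, hence its
  periods form a subgroup, generated by a divisor \<open>k\<close> of \<open>m\<close> which also divides all unused members.
  If \<open>k = m\<close>, then \<open>T\<close> contains the at least \<open>m - 1\<close> members outside \<open>m\<int>\<close>, and counting gives
  all residues. Otherwise induction applies modulo \<open>k\<close>,
  where the unused members vanish, so the sums of \<open>T\<close> meet every class modulo \<open>k\<close>, and \<open>k\<close> is a period.\<close>

lemma subset_sums_cover: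
  fixes d :: "'i \<Rightarrow> int" and m :: nat
  assumes fin: "finite I" and m: "m > 0"
    and out: "\<And>k. k dvd m \<Longrightarrow> 1 < k \<Longrightarrow> k - 1 \<le> card {i \<in> I. \<not> int k dvd d i}"
  shows "\<exists>J\<subseteq>I. int m dvd sum d J - t"
  using m out
proof (induction m arbitrary: t rule: less_induct)
  case (less m)
  define X where "X T = (\<lambda>J. sum d J mod int m) ` Pow T" for T
  have finX: "finite (X T)" if "T \<subseteq> I" for T
    using that fin finite_subset by (auto simp: X_def)
  have XI: "sum d J mod int m \<in> X T" if "J \<subseteq> T" for J T
    using that by (auto simp: X_def)
  let ?F = "{T. T \<subseteq> I \<and> card T < card (X T)}"
  have "{} \<in> ?F" by (simp add: X_def)
  moreover have "finite ?F" using fin by simp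
  ultimately have "\<exists>T\<in>?F. \<forall>T'\<in>?F. T \<subseteq> T' \<longrightarrow> T = T'"
    by (intro finite_has_maximal) auto
  then obtain T where T: "T \<subseteq> I" "card T < card (X T)"
    and max: "\<And>T'. T' \<subseteq> I \<Longrightarrow> card T' < card (X T') \<Longrightarrow> T \<subseteq> T' \<Longrightarrow> T = T'"
    by auto
  have finT: "finite T" using T(1) fin finite_subset by blast
  have stuck: "X (insert i T) = X T" if i: "i \<in> I - T" for i
  proof -
    have sub: "X T \<subseteq> X (insert i T)" by (auto simp: X_def)
    have "\<not> card (insert i T) < card (X (insert i T))"
      using max[of "insert i T"] i T(1) by blast
    then have "card (X (insert i T)) \<le> card (X T)"
      using i finT T(2) by simp
    then show ?thesis
      using card_seteq[OF finX sub] i T(1) by auto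
  qed
  \<comment> \<open>the periods of the set of subset sums of \<open>T\<close>, as a subgroup of the integers\<close>
  define S where "S = {e. \<forall>x. x mod int m \<in> X T \<longrightarrow> (x + e) mod int m \<in> X T}"
  have S_add: "e + f \<in> S" if "e \<in> S" "f \<in> S" for e f
    using that unfolding S_def by (auto simp: add.assoc[symmetric])
  have S_mult: "int c * e \<in> S" if "e \<in> S" for c e
  proof (induction c)
    case 0
    then show ?case by (simp add: S_def)
  next
    case (Suc c)
    then show ?case using S_add[OF \<open>e \<in> S\<close> Suc.IH] by (simp add: algebra_simps)
  qed
  have S_m: "int m * c \<in> S" for c
    by (simp add: S_def)
  have S_neg: "- e \<in> S" if "e \<in> S" for e
  proof -
    have "int (m - 1) * e + int m * (- e) \<in> S"
      by (intro S_add S_m S_mult that)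
    also have "int (m - 1) * e + int m * (- e) = - e"
      using less.prems(1) by (simp add: of_nat_diff algebra_simps)
    finally show ?thesis .
  qed
  have S_imult: "c * e \<in> S" if "e \<in> S" for c e
    using S_mult[OF that, of "nat c"] S_mult[OF S_neg[OF that], of "nat (- c)"]
    by (cases "c \<ge> 0") auto
  have S_d: "d i \<in> S" if i: "i \<in> I - T" for i
    unfolding S_def
  proof safe
    fix x assume "x mod int m \<in> X T"
    then obtain J where J: "J \<subseteq> T" "x mod int m = sum d J mod int m"
      by (auto simp: X_def)
    have "sum d (insert i J) = d i + sum d J"
      using i J(1) finT by (subst sum.insert) (auto intro: finite_subset)
    then have "(x + d i) mod int m = sum d (insert i J) mod int m"
      using J(2) by (metis add.commute mod_add_cong)
    moreover have "sum d (insert i J) mod int m \<in> X (insert i T)"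
      using J(1) by (intro XI) auto
    ultimately show "(x + d i) mod int m \<in> X T"
      using stuck[OF i] by simp
  qed
  define k where "k = (LEAST k. 0 < k \<and> int k \<in> S)"
  have "0 < m \<and> int m \<in> S" using less.prems(1) S_m[of 1] by simp
  then have k: "0 < k" "int k \<in> S"
    using LeastI[of "\<lambda>k. 0 < k \<and> int k \<in> S" m] unfolding k_def by blast+
  have k_least: "k \<le> l" if "0 < l" "int l \<in> S" for l
    unfolding k_def using that by (intro Least_le) simp
  have k_dvd: "int k dvd e" if "e \<in> S" for e
  proof (rule ccontr)
    assume ndvd: "\<not> int k dvd e"
    have "e + (- (e div int k)) * int k \<in> S"
      by (intro S_add S_imult that k)
    also have "e + (- (e div int k)) * int k = e mod int k"
      by (simp add: minus_div_mult_eq_mod)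
    finally have mod_S: "e mod int k \<in> S" .
    have "0 \<le> e mod int k" using k(1) by simp
    moreover have "e mod int k \<noteq> 0" using ndvd by (simp add: dvd_eq_mod_eq_0)
    ultimately have "k \<le> nat (e mod int k)" using mod_S by (intro k_least) simp_all
    then show False using k(1) pos_mod_bound[of "int k" e] by linarith
  qed
  have km: "k dvd m" using k_dvd[OF S_m[of 1]] by simp
  have "\<exists>J\<subseteq>T. int k dvd sum d J - t"
  proof (cases "k = m")
    case True
    have "m - 1 \<le> card T"
    proof (cases "m = 1")
      case False
      have "{i \<in> I. \<not> int m dvd d i} \<subseteq> T"
        using S_d k_dvd True by blast
      then have "card {i \<in> I. \<not> int m dvd d i} \<le> card T"
        by (intro card_mono finT)
      then show ?thesis using less.prems(2)[of m] less.prems(1) False by force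
    qed simp
    then have "card {0..<int m} \<le> card (X T)" using T(2) by simp
    moreover have "X T \<subseteq> {0..<int m}" using less.prems(1) by (auto simp: X_def)
    ultimately have "X T = {0..<int m}"
      by (intro card_seteq) auto
    then have "t mod int m \<in> X T" using less.prems(1) by simp
    then obtain J where "J \<subseteq> T" "t mod int m = sum d J mod int m"
      by (auto simp: X_def)
    then show ?thesis
      unfolding True by (intro exI[of _ J]) (auto simp: mod_eq_dvd_iff[symmetric])
  next
    case False
    then have "k < m" using dvd_imp_le[OF km] less.prems(1) by linarith
    moreover have "l - 1 \<le> card {i \<in> I. \<not> int l dvd d i}" if "l dvd k" "1 < l" for l
      using less.prems(2)[OF dvd_trans[OF that(1) km] that(2)] .
    ultimately obtain J where J: "J \<subseteq> I" "int k dvd sum d J - t"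
      using less.IH[of k t] k(1) by blast
    have "sum d J = sum d (J \<inter> T) + sum d (J - T)"
      using sum.Int_Diff[OF finite_subset[OF J(1) fin]] .
    moreover have "int k dvd sum d (J - T)"
      using J(1) S_d k_dvd by (intro dvd_sum) blast
    ultimately have "int k dvd sum d (J \<inter> T) - t"
      using J(2) dvd_diff[of "int k" "sum d J - t" "sum d (J - T)"] by (simp add: algebra_simps)
    then show ?thesis by blast
  qed
  then obtain J c where J: "J \<subseteq> T" "sum d J - t = int k * c" by blast
  have "- c * int k \<in> S" by (intro S_imult k)
  moreover have "sum d J + (- c * int k) = t" using J(2) by (simp add: algebra_simps)
  ultimately have "t mod int m \<in> X T"
    using XI[OF J(1)] unfolding S_def by force
  then obtain J' where "J' \<subseteq> T" "t mod int m = sum d J' mod int m"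
    by (auto simp: X_def)
  then show ?case
    using T(1) by (intro exI[of _ J']) (auto simp: mod_eq_dvd_iff[symmetric])
qed

section \<open>Balanced signed sums modulo an even number\<close>

text \<open>The value at \<open>card Q\<close> is the first element again, one turn later, so that the cyclic gap after
  the largest element is a difference of consecutive values like all others.\<close>

lemma cyclic_enumeration:
  fixes Q :: "nat set"
  assumes Q: "Q \<subseteq> {..<n}" "Q \<noteq> {}"
  obtains q where "\<And>i. i < card Q \<Longrightarrow> q i < q (Suc i)" "q (card Q) = q 0 + n" "q ` {..<card Q} = Q"
proof -
  define xs where "xs = sorted_list_of_set Q"
  have fin: "finite Q" using Q finite_subset by blast
  then have xs: "length xs = card Q" "set xs = Q" "sorted_wrt (<) xs"
    by (simp_all add: xs_def)
  have pos: "card Q > 0" using Q fin by (simp add: card_gt_0_iff)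
  define q where "q i = (if i < card Q then xs ! i else xs ! 0 + n)" for i
  have "q i < q (Suc i)" if i: "i < card Q" for i
  proof (cases "Suc i < card Q")
    case True
    then show ?thesis using xs sorted_wrt_nth_less[of "(<)" xs i "Suc i"] by (simp add: q_def)
  next
    case False
    have "xs ! i \<in> Q" using xs i by (metis nth_mem)
    then have "xs ! i < n" using Q by auto
    then show ?thesis using False i by (simp add: q_def)
  qed
  moreover have "q (card Q) = q 0 + n" using pos by (simp add: q_def)
  moreover have "q ` {..<card Q} = Q"
    using xs by (auto simp: q_def image_def in_set_conv_nth Bex_def)
  ultimately show ?thesis using that by blast
qed

lemma sum_even_odd_index:
  fixes f :: "nat \<Rightarrow> 'a :: comm_monoid_add"
  shows "sum f {..<2 * b} = (\<Sum>i<b. f (2 * i)) + (\<Sum>i<b. f (2 * i + 1))"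
  by (induction b) (simp_all add: algebra_simps)

text \<open>The \<open>2 * b\<close> cyclic gaps are positive and add up to \<open>n\<close>, and a gap divisible by \<open>k\<close> takes at
  least \<open>k\<close>. The count is split by the parity of the index since the gaps of even and of odd index
  belong to the two ways of pairing neighbours.\<close>

lemma card_divisible_gaps:
  fixes q :: "nat \<Rightarrow> nat"
  assumes q: "\<And>i. i < 2 * b \<Longrightarrow> q i < q (Suc i)" and wrap: "q (2 * b) = q 0 + n" and k: "k > 0"
  defines "g \<equiv> \<lambda>i. q (Suc i) - q i"
  shows "(k - 1) * (card {i. i < b \<and> k dvd g (2 * i)} + card {i. i < b \<and> k dvd g (2 * i + 1)}) + 2 * b \<le> n"
proof -
  have tele: "(\<Sum>i<l. g i) + q 0 = q l" if "l \<le> 2 * b" for l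
    using that
  proof (induction l)
    case (Suc l)
    then show ?case using q[of l] by (simp add: g_def)
  qed simp
  have gap: "(k - 1) * of_bool (k dvd g i) + 1 \<le> g i" if "i < 2 * b" for i
    using q[OF that] dvd_imp_le[of k "g i"] k by (auto simp: g_def)
  have card: "card {i. i < b \<and> k dvd g (f i)} = (\<Sum>i<b. of_bool (k dvd g (f i)))" for f
    by (simp add: Int_def conj_commute)
  have "(k - 1) * (card {i. i < b \<and> k dvd g (2 * i)} + card {i. i < b \<and> k dvd g (2 * i + 1)}) + 2 * b
     = (k - 1) * (\<Sum>i<2 * b. of_bool (k dvd g i)) + 2 * b"
    by (simp only: card sum_even_odd_index)
  also have "\<dots> = (\<Sum>i<2 * b. (k - 1) * of_bool (k dvd g i) + 1)"
    by (simp only: sum.distrib sum_distrib_left sum_constant card_lessThan of_nat_id mult_1_right)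
  also have "\<dots> \<le> (\<Sum>i<2 * b. g i)"
    using gap by (intro sum_mono) auto
  also have "\<dots> = n" using tele[of "2 * b"] wrap by simp
  finally show ?thesis .
qed

text \<open>Here \<open>2 * r\<close> and \<open>2 * b\<close> are the numbers of rotations and reflections, \<open>j\<close> is the number of pairs
  whose gap is divisible by \<open>k\<close>, and \<open>c\<close> that of rotation exponents outside \<open>k\<int>\<close>. The estimate for
  \<open>b + c - j\<close> is worst at \<open>r = l\<close>, where all rotations may lie in \<open>k\<int>\<close>; there \<open>k - 1\<close>
  times it is at least \<open>l * (k * k - 2 * k - 1)\<close>. This need only exceed \<open>(k - 1) * (k - 2)\<close>, because
  \<open>b + c - j\<close> is an integer; for \<open>k = 3\<close>, \<open>l = 1\<close> both are 2.\<close>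

lemma enough_outside:
  fixes k l r b j c :: nat
  assumes k: "3 \<le> k" "1 \<le> l" "k \<noteq> 3 \<or> l \<noteq> 1" and rb: "r + b = k * l"
    and j: "(k - 1) * j \<le> 2 * r" and c: "2 * r \<le> c + 2 * l"
  shows "k - 1 + j \<le> b + c"
proof (rule ccontr)
  assume "\<not> ?thesis"
  then have less: "b + c + 2 \<le> k + j" using k by linarith
  obtain K where K: "k = K + 3" using k(1) by (metis add.commute le_Suc_ex)
  have "(K + 2) * (b + c + 2) \<le> (K + 2) * (K + 3 + j)"
    using less K by (intro mult_left_mono) auto
  then have 1: "(K + 2) * b + (K + 2) * c \<le> (K + 2) * (K + 1) + 2 * r"
    using j K by (simp add: algebra_simps)
  \<comment> \<open>with \<open>k = K + 3\<close>: \<open>(k - 1) * (k - 2) < l * (k * k - 2 * k - 1)\<close>\<close>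
  have big: "(K + 2) * (K + 1) < l * (K * K + 4 * K + 2)"
  proof (cases "l = 1")
    case True
    then show ?thesis using k K by simp
  next
    case False
    then have "2 * (K * K + 4 * K + 2) \<le> l * (K * K + 4 * K + 2)"
      using k by (intro mult_right_mono) auto
    then show ?thesis by simp
  qed
  show False
  proof (cases "r \<le> l")
    case True
    have "(K + 2) * r + (K + 2) * b = (K + 2) * ((K + 3) * l)"
      using rb K by (metis distrib_left)
    moreover have "(K + 4) * r \<le> (K + 4) * l" using True by simp
    ultimately show False using 1 big by (simp add: algebra_simps)
  next
    case False
    then obtain d where d: "r = l + d" by (metis le_Suc_ex nat_le_linear)
    have "(K + 2) * (2 * d) \<le> (K + 2) * c" using c d by (intro mult_left_mono) auto
    moreover have "(K + 2) * (l + d) + (K + 2) * b = (K + 2) * ((K + 3) * l)"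
      using rb K d by (metis distrib_left)
    ultimately show False using 1 big d by (simp add: algebra_simps)
  qed
qed

text \<open>The index \<open>c\<close> selects one of the two pairings of cyclic neighbours. Every modulus \<open>k \<ge> 3\<close> with
  \<open>m > 3\<close> is served by either of them. For even \<open>m\<close> the choice is made so that the modulus 2 is
  served, for \<open>m = 3\<close> so that at most half of the gaps divisible by 3 are used.\<close>

lemma pairing_hits_all_moduli:
  fixes P Q :: "nat set" and q :: "nat \<Rightarrow> nat"
  assumes P: "P \<subseteq> {..<2 * m}" "card P = 2 * r" and rb: "r + b = m" "1 \<le> b"
    and q: "\<And>i. i < 2 * b \<Longrightarrow> q i < q (Suc i)" and wrap: "q (2 * b) = q 0 + 2 * m"
    and mixed: "(\<exists>p\<in>P. odd p) \<or> (\<exists>i<2 * b. even (q i)) \<and> (\<exists>i<2 * b. odd (q i))"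
  defines "g \<equiv> \<lambda>i. q (Suc i) - q i"
  obtains c where "c = 0 \<or> c = 1"
    "\<And>k. k dvd m \<Longrightarrow> 1 < k \<Longrightarrow>
       k - 1 \<le> card {p \<in> P. \<not> k dvd p} + card {i. i < b \<and> \<not> k dvd g (2 * i + c)}"
proof -
  define j where "j c k = card {i. i < b \<and> k dvd g (2 * i + c)}" for c k
  have gaps: "(k - 1) * (j 0 k + j 1 k) + 2 * b \<le> 2 * m" if "k > 0" for k
    using card_divisible_gaps[OF q wrap that] by (simp add: j_def g_def)
  have finP: "finite P" using P finite_subset by blast
  have compl: "card {i. i < b \<and> \<not> k dvd g (2 * i + c)} + j c k = b" for k c
  proof -
    have "card {i. i < b \<and> \<not> k dvd g (2 * i + c)} + j c k
        = card ({i. i < b \<and> \<not> k dvd g (2 * i + c)} \<union> {i. i < b \<and> k dvd g (2 * i + c)})"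
      unfolding j_def by (rule card_Un_disjoint[symmetric]) auto
    also have "{i. i < b \<and> \<not> k dvd g (2 * i + c)} \<union> {i. i < b \<and> k dvd g (2 * i + c)} = {..<b}"
      by auto
    finally show ?thesis by simp
  qed
  have rot: "2 * r \<le> card {p \<in> P. \<not> k dvd p} + 2 * l" if "m = k * l" "k > 0" for k l
  proof -
    have "{p \<in> P. k dvd p} \<subseteq> (\<lambda>i. k * i) ` {..<2 * l}"
      using P(1) that by (auto elim!: dvdE)
    then have "card {p \<in> P. k dvd p} \<le> 2 * l"
      using surj_card_le[of "{..<2 * l}"] by auto
    moreover have "card P = card ({p \<in> P. \<not> k dvd p} \<union> {p \<in> P. k dvd p})"
      by (rule arg_cong[of _ _ card]) auto
    moreover have "\<dots> = card {p \<in> P. \<not> k dvd p} + card {p \<in> P. k dvd p}"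
      using finP by (intro card_Un_disjoint) auto
    ultimately show ?thesis using P(2) by linarith
  qed
  obtain c where c: "c = 0 \<or> c = 1"
    and c2: "even m \<Longrightarrow> (\<exists>p\<in>P. odd p) \<or> (\<exists>i<b. odd (g (2 * i + c)))"
    and c3: "m = 3 \<Longrightarrow> 2 * j c 3 \<le> r"
  proof (cases "even m")
    case True
    have "\<exists>c. (c = 0 \<or> c = 1) \<and> ((\<exists>p\<in>P. odd p) \<or> (\<exists>i<b. odd (g (2 * i + c))))"
    proof (rule ccontr)
      assume neg: "\<not> ?thesis"
      have ev: "even (g i)" if "i < 2 * b" for i
      proof -
        have "i = 2 * (i div 2) + i mod 2" "i div 2 < b" "i mod 2 = 0 \<or> i mod 2 = 1"
          using that by auto
        then show ?thesis using neg by metis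
      qed
      have "even (q i) = even (q 0)" if "i < 2 * b" for i
        using that
      proof (induction i)
        case (Suc i)
        have "even (q (Suc i)) = even (q i)"
          using ev[of i] q[of i] Suc.prems by (simp add: g_def)
        then show ?case using Suc by simp
      qed simp
      then show False using mixed neg by blast
    qed
    moreover have "m \<noteq> 3" using True by auto
    ultimately show ?thesis using that by blast
  next
    case False
    have "\<exists>c. (c = 0 \<or> c = 1) \<and> (m = 3 \<longrightarrow> 2 * j c 3 \<le> r)"
    proof (cases "j 0 3 \<le> j 1 3")
      case True
      then show ?thesis using gaps[of 3] rb by (intro exI[of _ 0]) auto
    next
      case False
      then show ?thesis using gaps[of 3] rb by (intro exI[of _ 1]) auto
    qed
    then show ?thesis using that False by blast
  qed
  have "k - 1 \<le> card {p \<in> P. \<not> k dvd p} + card {i. i < b \<and> \<not> k dvd g (2 * i + c)}"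
    if k: "k dvd m" "1 < k" for k
  proof -
    obtain l where l: "m = k * l" using k by blast
    have l0: "l \<ge> 1" using l rb by (cases l) auto
    have R: "2 * r \<le> card {p \<in> P. \<not> k dvd p} + 2 * l" using rot l k by simp
    have jc: "j c k \<le> j 0 k + j 1 k" using c by auto
    consider "k = 2" | "k = 3" "l = 1" | "3 \<le> k" "k \<noteq> 3 \<or> l \<noteq> 1" using k by linarith
    then show ?thesis
    proof cases
      case 1
      consider p where "p \<in> P" "odd p" | i where "i < b" "odd (g (2 * i + c))"
        using c2 k 1 by blast
      then show ?thesis
      proof cases
        case (1 p)
        then have "card {p \<in> P. \<not> k dvd p} > 0"
          using finP \<open>k = 2\<close> by (auto simp: card_gt_0_iff)
        then show ?thesis using \<open>k = 2\<close> by simp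
      next
        case (2 i)
        then have "card {i. i < b \<and> \<not> k dvd g (2 * i + c)} > 0"
          using \<open>k = 2\<close> by (auto simp: card_gt_0_iff)
        then show ?thesis using \<open>k = 2\<close> by simp
      qed
    next
      case 2
      then show ?thesis using c3 l R compl[of 3 c] rb by auto
    next
      case 3
      have "(k - 1) * j c k \<le> (k - 1) * (j 0 k + j 1 k)" using jc by (rule mult_le_mono2)
      then have "(k - 1) * j c k \<le> 2 * r" using gaps[of k] k rb by linarith
      then have "k - 1 + j c k \<le> b + card {p \<in> P. \<not> k dvd p}"
        using enough_outside[OF 3(1) l0 3(2) _ _ R] rb l by blast
      then show ?thesis using compl[of k c] by linarith
    qed
  qed
  then show ?thesis using that c by blast
qed

lemma sum_negate_on_subset:
  fixes f :: "'a \<Rightarrow> 'b :: ab_group_add"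
  assumes "finite A" "B \<subseteq> A"
  shows "(\<Sum>x\<in>A. if x \<in> B then - f x else f x) = sum f (A - B) - sum f B"
  using assms by (simp add: sum.If_cases sum_negf Int_absorb1 Diff_eq[symmetric])

text \<open>The elements of \<open>N\<close> are the rotation exponents that get a minus sign; the pairs \<open>(u i, v i)\<close>, modulo \<open>2 * m\<close>,
  partition the reflection exponents. Flipping the signs of a subfamily \<open>J\<close> changes the sum of all
  rotation exponents and gaps by twice the sum over \<open>J\<close>. The full sum is even, say \<open>2 * t\<close>, so it suffices
  to reach \<open>t\<close> modulo \<open>m\<close> by a subset sum.\<close>

lemma balanced_signed_sum:
  fixes P Q :: "nat set"
  assumes P: "P \<subseteq> {..<2 * m}" and Q: "Q \<subseteq> {..<2 * m}"
    and card: "card P + card Q = 2 * m" "card Q = 2 * b" "1 \<le> b"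
    and parity: "even (\<Sum>P + \<Sum>Q)"
    and mixed: "(\<exists>p\<in>P. odd p) \<or> (\<exists>q\<in>Q. even q) \<and> (\<exists>q\<in>Q. odd q)"
  obtains N u v where "N \<subseteq> P"
    "(\<lambda>i. u i mod (2 * m)) ` {..<b} \<union> (\<lambda>i. v i mod (2 * m)) ` {..<b} = Q"
    "int (2 * m) dvd (\<Sum>p\<in>P - N. int p) - (\<Sum>p\<in>N. int p) + (\<Sum>i<b. int (v i) - int (u i))"
proof -
  define n where "n = 2 * m"
  have "Q \<noteq> {}" using card by auto
  then obtain q where q: "\<And>i. i < 2 * b \<Longrightarrow> q i < q (Suc i)" "q (2 * b) = q 0 + n" "q ` {..<2 * b} = Q"
    using cyclic_enumeration[OF Q] card n_def by metis
  obtain r where r: "card P = 2 * r" "r + b = m"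
    using card that[of "m - b"] by auto
  define g where "g i = q (Suc i) - q i" for i
  have q_mixed: "(\<exists>p\<in>P. odd p) \<or> (\<exists>i<2 * b. even (q i)) \<and> (\<exists>i<2 * b. odd (q i))"
    using mixed unfolding q(3)[symmetric] by auto
  obtain c where c: "c = 0 \<or> c = 1"
    and out: "\<And>k. k dvd m \<Longrightarrow> 1 < k \<Longrightarrow>
       k - 1 \<le> card {p \<in> P. \<not> k dvd p} + card {i. i < b \<and> \<not> k dvd g (2 * i + c)}"
    by (rule pairing_hits_all_moduli[OF P r card(3), of q, folded g_def])
      (use q(1,2) q_mixed n_def in blast)+
  have finP: "finite P" using P finite_subset by blast
  define I where "I = P <+> {..<b}"
  define d where "d = case_sum int (\<lambda>i. int (g (2 * i + c)))"
  have finI: "finite I" using finP by (simp add: I_def)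
  have gap: "int (g i) = int (q (Suc i)) - int (q i)" if "i < 2 * b" for i
    using q(1)[OF that] by (simp add: g_def of_nat_diff)
  have less: "2 * i + c < 2 * b" if "i < b" for i using that c by auto
  have "inj_on q {..<2 * b}" using q(3) card(2) by (intro eq_card_imp_inj_on) auto
  then have sumQ: "(\<Sum>i<2 * b. q i) = \<Sum>Q"
    using q(3) by (metis sum.reindex_cong)
  \<comment> \<open>the second pairing replaces the smallest exponent by itself plus \<open>n\<close>\<close>
  have "(\<Sum>i<2 * b. q (i + c)) = \<Sum>Q + c * n"
    using c
  proof
    assume "c = 1"
    have "(\<Sum>i<2 * b. q (Suc i)) + q 0 = (\<Sum>i<2 * b. q i) + q (2 * b)"
      by (metis add.commute sum.lessThan_Suc sum.lessThan_Suc_shift)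
    then show ?thesis using q(2) sumQ \<open>c = 1\<close> by simp
  qed (use sumQ in simp)
  then have "\<Sum>P + (\<Sum>i<b. q (2 * i + c) + q (2 * i + 1 + c)) = \<Sum>P + \<Sum>Q + c * n"
    by (simp add: sum_even_odd_index sum.distrib)
  then have even_abs: "even (\<Sum>P + (\<Sum>i<b. q (2 * i + c) + q (2 * i + 1 + c)))"
    using parity by (simp add: n_def)
  have sumI: "sum d I = int (\<Sum>P) + (\<Sum>i<b. int (g (2 * i + c)))"
    using finP by (simp add: I_def d_def sum.Plus)
  have "(\<Sum>i<b. int (g (2 * i + c))) = (\<Sum>i<b. int (q (2 * i + c) + q (2 * i + 1 + c)) - 2 * int (q (2 * i + c)))"
    by (intro sum.cong) (auto simp: gap less)
  also have "\<dots> = int (\<Sum>i<b. q (2 * i + c) + q (2 * i + 1 + c)) - 2 * (\<Sum>i<b. int (q (2 * i + c)))"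
    by (simp add: sum_subtractf sum.distrib sum_distrib_left[symmetric])
  finally have sumI_abs: "sum d I = int (\<Sum>P + (\<Sum>i<b. q (2 * i + c) + q (2 * i + 1 + c))) - 2 * (\<Sum>i<b. int (q (2 * i + c)))"
    unfolding sumI by simp
  have "even (sum d I)"
    unfolding sumI_abs by (intro dvd_diff dvd_triv_left) (simp only: even_of_nat even_abs)
  then obtain t where t: "sum d I = 2 * t" by blast
  have "m > 0" using r card by simp
  moreover have "k - 1 \<le> card {x \<in> I. \<not> int k dvd d x}" if "k dvd m" "1 < k" for k
  proof -
    have "{x \<in> I. \<not> int k dvd d x} = {p \<in> P. \<not> k dvd p} <+> {i. i < b \<and> \<not> k dvd g (2 * i + c)}"
      by (auto simp: I_def d_def)
    then show ?thesis using out[OF that] finP by (simp add: card_Plus)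
  qed
  ultimately obtain J where J: "J \<subseteq> I" "int m dvd sum d J - t"
    using subset_sums_cover[OF finI, of m d t] by blast
  define N where "N = {p \<in> P. Inl p \<in> J}"
  define u where "u i = (if Inr i \<in> J then q (2 * i + 1 + c) else q (2 * i + c))" for i
  define v where "v i = (if Inr i \<in> J then q (2 * i + c) else q (2 * i + 1 + c))" for i
  have "sum d I - 2 * sum d J = sum d (I - J) - sum d J"
    using sum.subset_diff[OF J(1) finI, of d] by simp
  also have "\<dots> = (\<Sum>x\<in>I. if x \<in> J then - d x else d x)"
    by (rule sum_negate_on_subset[OF finI J(1), symmetric])
  also have "\<dots> = (\<Sum>p\<in>P. if p \<in> N then - int p else int p) + (\<Sum>i<b. int (v i) - int (u i))"
    using finP gap less by (auto simp: I_def d_def N_def u_def v_def sum.Plus intro!: arg_cong2[of _ _ _ _ "(+)"] sum.cong)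
  also have "(\<Sum>p\<in>P. if p \<in> N then - int p else int p) = (\<Sum>p\<in>P - N. int p) - (\<Sum>p\<in>N. int p)"
    using finP by (intro sum_negate_on_subset) (auto simp: N_def)
  finally have "sum d I - 2 * sum d J = (\<Sum>p\<in>P - N. int p) - (\<Sum>p\<in>N. int p) + (\<Sum>i<b. int (v i) - int (u i))" .
  moreover have "int n dvd sum d I - 2 * sum d J"
  proof -
    have "2 * int m dvd 2 * (sum d J - t)" using J(2) by (rule mult_dvd_mono[OF dvd_refl])
    then have "2 * int m dvd - (2 * (sum d J - t))" by (simp only: dvd_minus_iff)
    then show ?thesis by (simp add: n_def t algebra_simps)
  qed
  moreover have "(\<lambda>i. u i mod n) ` {..<b} \<union> (\<lambda>i. v i mod n) ` {..<b} = Q"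
  proof -
    have qn: "q i mod n = q i" if "i < 2 * b" for i
      using that q(3) Q by (auto simp: n_def)
    have wrap: "q (2 * b) mod n = q 0" using q(2) qn[of 0] card(3) by simp
    have "(\<lambda>i. u i mod n) ` {..<b} \<union> (\<lambda>i. v i mod n) ` {..<b}
        = (\<lambda>i. q (2 * i + c) mod n) ` {..<b} \<union> (\<lambda>i. q (2 * i + 1 + c) mod n) ` {..<b}"
      by (auto simp: u_def v_def image_def)
    also have "\<dots> = (\<lambda>i. q (i + c) mod n) ` {..<2 * b}"
    proof (intro equalityI subsetI)
      fix x assume "x \<in> (\<lambda>i. q (i + c) mod n) ` {..<2 * b}"
      then obtain i where i: "i < 2 * b" "x = q (i + c) mod n" by auto
      have "i = 2 * (i div 2) \<or> i = 2 * (i div 2) + 1" by presburger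
      moreover have "i div 2 < b" using i(1) by auto
      ultimately obtain h where "h < b" "i = 2 * h \<or> i = 2 * h + 1" by blast
      then show "x \<in> (\<lambda>i. q (2 * i + c) mod n) ` {..<b} \<union> (\<lambda>i. q (2 * i + 1 + c) mod n) ` {..<b}"
        using i(2) by auto
    next
      fix x assume "x \<in> (\<lambda>i. q (2 * i + c) mod n) ` {..<b} \<union> (\<lambda>i. q (2 * i + 1 + c) mod n) ` {..<b}"
      then obtain h where "h < b" "x = q (2 * h + c) mod n \<or> x = q (2 * h + 1 + c) mod n" by auto
      then show "x \<in> (\<lambda>i. q (i + c) mod n) ` {..<2 * b}"
        by (elim disjE) (auto intro: image_eqI[of _ _ "2 * h"] image_eqI[of _ _ "2 * h + 1"])
    qed
    also have "\<dots> = q ` {..<2 * b}"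
      using c
    proof
      assume "c = 0"
      then show ?thesis using qn by (auto intro!: image_cong)
    next
      assume c: "c = 1"
      show ?thesis
      proof (intro equalityI subsetI)
        fix x assume "x \<in> q ` {..<2 * b}"
        then obtain i where i: "i < 2 * b" "x = q i" by auto
        show "x \<in> (\<lambda>i. q (i + c) mod n) ` {..<2 * b}"
        proof (cases i)
          case 0
          then show ?thesis using i c wrap card(3) by (intro rev_image_eqI[of "2 * b - 1"]) auto
        next
          case (Suc k)
          then show ?thesis using i c qn[of i] by (intro rev_image_eqI[of k]) auto
        qed
      next
        fix x assume "x \<in> (\<lambda>i. q (i + c) mod n) ` {..<2 * b}"
        then obtain i where i: "i < 2 * b" "x = q (Suc i) mod n" using c by auto
        show "x \<in> q ` {..<2 * b}"
        proof (cases "Suc i < 2 * b")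
          case True
          then show ?thesis using i qn[of "Suc i"] by auto
        next
          case False
          then have "Suc i = 2 * b" using i by simp
          then show ?thesis using i wrap card(3) by auto
        qed
      qed
    qed
    finally show ?thesis using q(3) by simp
  qed
  moreover have "N \<subseteq> P" by (auto simp: N_def)
  ultimately show ?thesis using that[of N u v] by (simp only: n_def)
qed

section \<open>Choosing the two elements to leave out\<close>

text \<open>The numbers of even and odd rotation exponents (\<open>pe\<close>, \<open>po\<close>) and reflection exponents (\<open>qe\<close>,
  \<open>qo\<close>) among the \<open>2 * m + 2\<close> given elements, each at most \<open>m\<close>. The parities of \<open>qe + qo\<close> and
  \<open>po + qo\<close> prescribe which kinds of pairs may be dropped. For each of the four parity combinations, two or three
  such kinds suffice: if one is unavailable or leaves a degenerate configuration, another one works.\<close>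

lemma deletion_counts:
  fixes m pe po qe qo :: nat
  assumes "m \<ge> 2" "pe \<le> m" "po \<le> m" "qe \<le> m" "qo \<le> m" "pe + po + qe + qo = 2 * m + 2"
  shows "\<exists>pe' po' qe' qo'. pe' \<le> pe \<and> po' \<le> po \<and> qe' \<le> qe \<and> qo' \<le> qo
     \<and> pe' + po' + qe' + qo' = 2 * m \<and> even (qe' + qo') \<and> 2 \<le> qe' + qo' \<and> even (po' + qo')
     \<and> (0 < po' \<or> 0 < qe' \<and> 0 < qo')"
proof (rule ccontr)
  assume neg: "\<not> ?thesis"
  note N = neg[unfolded not_ex, rule_format]
  have c: False if "a + b + c + d = 2" "a \<le> pe" "b \<le> po" "c \<le> qe" "d \<le> qo" 
     "even (qe + qo + c + d)" "even (po + qo + b + d)" "2 + c + d \<le> qe + qo" "b < po \<or> c < qe \<and> d < qo" for a b c d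
    using N[of "pe - a" "po - b" "qe - c" "qo - d"] that assms(6)
    by (auto simp: even_diff_nat)
  consider "even (qe + qo)" "even (po + qo)" | "even (qe + qo)" "odd (po + qo)"
    | "odd (qe + qo)" "even (po + qo)" | "odd (qe + qo)" "odd (po + qo)" by blast
  then show False
  proof cases
    case 1
    then show ?thesis using c[of 2 0 0 0] c[of 0 2 0 0] c[of 0 0 2 0] assms(1-6) by simp linarith
  next
    case 2
    then show ?thesis using c[of 1 1 0 0] c[of 0 0 1 1] assms(1-6) by simp linarith
  next
    case 3
    then have "qe + qo \<noteq> 2" by fastforce
    with 3 show ?thesis using c[of 1 0 1 0] c[of 0 1 0 1] assms(1-6) by simp linarith
  next
    case 4
    then have "qe + qo \<noteq> 2" by fastforce
    with 4 show ?thesis using c[of 1 0 0 1] c[of 0 1 1 0] assms(1-6) by simp linarith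
  qed
qed

text \<open>Realises the counts of lemma \<open>deletion_counts\<close> by actual sets of exponents.\<close>

lemma subset_with_parity_counts:
  fixes A :: "nat set"
  assumes A: "finite A" and e: "e \<le> card {a \<in> A. even a}" and d: "d \<le> card {a \<in> A. odd a}"
  obtains B where "B \<subseteq> A" "card B = e + d" "even (\<Sum>B) \<longleftrightarrow> even d"
    "0 < e \<Longrightarrow> \<exists>a\<in>B. even a" "0 < d \<Longrightarrow> \<exists>a\<in>B. odd a"
proof -
  obtain E where E: "E \<subseteq> {a \<in> A. even a}" "card E = e" "finite E"
    using obtain_subset_with_card_n[OF e] by blast
  obtain D where D: "D \<subseteq> {a \<in> A. odd a}" "card D = d" "finite D"
    using obtain_subset_with_card_n[OF d] by blast
  have disj: "E \<inter> D = {}" using E D by auto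
  have "even (\<Sum>E)" using E by (intro dvd_sum) auto
  moreover have "even (\<Sum>D) \<longleftrightarrow> even (card D)"
  proof -
    have "{a \<in> D. odd a} = D" using D by auto
    then show ?thesis using D(3) even_sum_iff[of D "\<lambda>a. a"] by simp
  qed
  ultimately have "even (\<Sum>(E \<union> D)) \<longleftrightarrow> even d"
    using E D disj by (simp add: sum.union_disjoint)
  moreover have "card (E \<union> D) = e + d" using E D disj by (simp add: card_Un_disjoint)
  moreover have "\<exists>a\<in>E \<union> D. even a" if "0 < e" using that E by (metis (mono_tags, lifting) Un_iff card_gt_0_iff ex_in_conv mem_Collect_eq subsetD)
  moreover have "\<exists>a\<in>E \<union> D. odd a" if "0 < d" using that D by (metis (mono_tags, lifting) Un_iff card_gt_0_iff ex_in_conv mem_Collect_eq subsetD)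
  moreover have "E \<union> D \<subseteq> A" using E D by auto
  ultimately show ?thesis using that by blast
qed

lemma card_parity_classes:
  fixes A :: "nat set"
  assumes "A \<subseteq> {..<2 * m}"
  shows "card {a \<in> A. even a} \<le> m" "card {a \<in> A. odd a} \<le> m"
    "card {a \<in> A. even a} + card {a \<in> A. odd a} = card A"
proof -
  have "{a \<in> A. even a} \<subseteq> (\<lambda>i. 2 * i) ` {..<m}" "{a \<in> A. odd a} \<subseteq> (\<lambda>i. 2 * i + 1) ` {..<m}"
    using assms by (auto elim!: evenE oddE)
  then show "card {a \<in> A. even a} \<le> m" "card {a \<in> A. odd a} \<le> m"
    by (auto dest: surj_card_le[rotated])
  have "finite A" using assms finite_subset by blast
  then have "card {a \<in> A. even a} + card {a \<in> A. odd a} = card ({a \<in> A. even a} \<union> {a \<in> A. odd a})"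
    by (intro card_Un_disjoint[symmetric]) auto
  also have "{a \<in> A. even a} \<union> {a \<in> A. odd a} = A" by auto
  finally show "card {a \<in> A. even a} + card {a \<in> A. odd a} = card A" .
qed

section \<open>Products in the dihedral group as signed sums\<close>

text \<open>Group elements are encoded by pairs: \<open>(False, a)\<close> is \<open>y ^ a\<close> and \<open>(True, a)\<close> is \<open>x * y ^ a\<close>.\<close>

definition code_word :: "bool \<times> nat \<Rightarrow> dihedral_gen word" where
  "code_word c = (if fst c then [(gen_x, True)] else []) @ replicate (snd c) (gen_y, True)"

definition dihedral_elem :: "nat \<Rightarrow> bool \<times> nat \<Rightarrow> dihedral_gen word set" where
  "dihedral_elem n c = {w. word_eq (dihedral_relators n) (code_word c) w}"

definition code_sign :: "bool \<times> nat \<Rightarrow> int" where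
  "code_sign c = (if fst c then - 1 else 1)"

text \<open>The translation part of the product of the encoded elements, acting on the integers by
  affine maps as in the definition of \<open>shift_part\<close>.\<close>

fun net_shift :: "(bool \<times> nat) list \<Rightarrow> int" where
  "net_shift [] = 0"
| "net_shift ((s, a) # cs) = (if s then - net_shift cs - int a else net_shift cs + int a)"

lemma code_word_parts:
  "sgn_part (code_word c) = code_sign c"
  "shift_part (code_word c) = code_sign c * int (snd c)"
  by (simp_all add: code_word_def code_sign_def sgn_part_append shift_part_append sgn_shift_part_y)

text \<open>Distinct normal forms have distinct invariants, so the invariants are complete.\<close>

lemma dihedral_word_eq_iff:
  assumes n: "n > 0"
  shows "word_eq (dihedral_relators n) u v \<longleftrightarrow>
    sgn_part u = sgn_part v \<and> int n dvd shift_part u - shift_part v"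
proof (intro iffI word_eq_dihedral_invariant)
  assume uv: "sgn_part u = sgn_part v \<and> int n dvd shift_part u - shift_part v"
  have normal: "\<exists>c. snd c < n \<and> word_eq (dihedral_relators n) w (code_word c)" for w
  proof -
    obtain a b where ab: "a < 2" "b < n" "word_eq (dihedral_relators n) w
        (replicate a (gen_x, True) @ replicate b (gen_y, True))"
      using dihedral_normal_form[OF n] by blast
    moreover have "replicate a (gen_x, True) @ replicate b (gen_y, True) = code_word (a = 1, b)"
      using ab(1) by (cases a) (auto simp: code_word_def)
    ultimately show ?thesis by (metis snd_conv)
  qed
  obtain c d where c: "snd c < n" "word_eq (dihedral_relators n) u (code_word c)"
    and d: "snd d < n" "word_eq (dihedral_relators n) v (code_word d)"
    using normal by blast
  have cu: "sgn_part u = code_sign c" "int n dvd shift_part u - code_sign c * int (snd c)"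
    using word_eq_dihedral_invariant[OF c(2)] by (simp_all add: code_word_parts)
  have dv: "sgn_part v = code_sign d" "int n dvd shift_part v - code_sign d * int (snd d)"
    using word_eq_dihedral_invariant[OF d(2)] by (simp_all add: code_word_parts)
  have s: "fst c = fst d" using uv cu dv by (auto simp: code_sign_def split: if_splits)
  have "int n dvd (shift_part u - shift_part v) - (shift_part u - code_sign c * int (snd c))
      + (shift_part v - code_sign d * int (snd d))"
    by (rule dvd_add[OF dvd_diff[OF conjunct2[OF uv] cu(2)] dv(2)])
  also have "\<dots> = code_sign c * (int (snd c) - int (snd d))"
    using s by (simp add: code_sign_def algebra_simps)
  finally have "int n dvd int (snd c) - int (snd d)"
    by (auto simp: code_sign_def dvd_diff_commute split: if_splits)
  then have "snd c = snd d"
    using c(1) d(1) by (simp add: mod_eq_dvd_iff[symmetric] flip: of_nat_mod)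
  then have "c = d" using s by (simp add: prod_eq_iff)
  then show "word_eq (dihedral_relators n) u v"
    using c d by (blast intro: word_eq.trans word_eq.sym)
qed

lemma dihedral_class_eq_iff:
  assumes "n > 0"
  shows "{w. word_eq (dihedral_relators n) u w} = {w. word_eq (dihedral_relators n) v w} \<longleftrightarrow>
    sgn_part u = sgn_part v \<and> int n dvd shift_part u - shift_part v"
  unfolding word_class_eq_iff by (rule dihedral_word_eq_iff[OF assms])

lemma dihedral_elem_bij:
  assumes n: "n > 0"
  shows "bij_betw (dihedral_elem n) (UNIV \<times> {..<n}) (carrier (dihedral_group n))"
proof -
  have inj: "inj_on (dihedral_elem n) (UNIV \<times> {..<n})"
  proof (rule inj_onI)
    fix c d :: "bool \<times> nat"
    assume cd: "c \<in> UNIV \<times> {..<n}" "d \<in> UNIV \<times> {..<n}" "dihedral_elem n c = dihedral_elem n d"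
    then have *: "code_sign c = code_sign d"
        "int n dvd code_sign c * int (snd c) - code_sign d * int (snd d)"
      unfolding dihedral_elem_def dihedral_class_eq_iff[OF n] code_word_parts by blast+
    then have s: "fst c = fst d" by (auto simp: code_sign_def split: if_splits)
    have "int n dvd int (snd c) - int (snd d)"
      using * by (auto simp: code_sign_def dvd_diff_commute split: if_splits)
    then have "snd c = snd d"
      using cd(1,2) by (simp add: mod_eq_dvd_iff[symmetric] mem_Times_iff flip: of_nat_mod)
    then show "c = d" using s by (simp add: prod_eq_iff)
  qed
  moreover have "dihedral_elem n ` (UNIV \<times> {..<n}) = carrier (dihedral_group n)"
  proof (rule card_seteq)
    show "finite (carrier (dihedral_group n))"
      using order_dihedral_group[OF n] n by (intro card_ge_0_finite) (simp add: order_def)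
    show "dihedral_elem n ` (UNIV \<times> {..<n}) \<subseteq> carrier (dihedral_group n)"
      by (auto simp: dihedral_elem_def dihedral_group_def carrier_presented_group)
    show "card (carrier (dihedral_group n)) \<le> card (dihedral_elem n ` (UNIV \<times> {..<n}))"
      using order_dihedral_group[OF n] by (simp add: order_def card_image[OF inj] card_cartesian_product)
  qed
  ultimately show ?thesis by (simp add: bij_betw_def)
qed

lemma foldr_dihedral_elem:
  "foldr (\<otimes>\<^bsub>dihedral_group n\<^esub>) (map (dihedral_elem n) cs) \<one>\<^bsub>dihedral_group n\<^esub>
    = {w. word_eq (dihedral_relators n) (concat (map code_word cs)) w}"
  by (induction cs) (simp_all add: dihedral_group_def one_presented_group dihedral_elem_def mult_presented_group)

lemma concat_code_word_parts:
  "sgn_part (concat (map code_word cs)) = (\<Prod>c\<leftarrow>cs. code_sign c)"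
  "shift_part (concat (map code_word cs)) = net_shift cs"
  by (induction cs rule: net_shift.induct)
    (simp_all add: sgn_part_append shift_part_append code_word_parts code_sign_def)

lemma foldr_dihedral_elem_eq_one_iff:
  assumes "n > 0"
  shows "foldr (\<otimes>\<^bsub>dihedral_group n\<^esub>) (map (dihedral_elem n) cs) \<one>\<^bsub>dihedral_group n\<^esub> = \<one>\<^bsub>dihedral_group n\<^esub>
    \<longleftrightarrow> (\<Prod>c\<leftarrow>cs. code_sign c) = 1 \<and> int n dvd net_shift cs"
proof -
  have "foldr (\<otimes>\<^bsub>dihedral_group n\<^esub>) (map (dihedral_elem n) cs) \<one>\<^bsub>dihedral_group n\<^esub> = \<one>\<^bsub>dihedral_group n\<^esub>
    \<longleftrightarrow> {w. word_eq (dihedral_relators n) (concat (map code_word cs)) w}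
      = {w. word_eq (dihedral_relators n) [] w}"
    unfolding foldr_dihedral_elem by (simp add: dihedral_group_def one_presented_group)
  then show ?thesis
    by (simp only: dihedral_class_eq_iff[OF assms] concat_code_word_parts) simp
qed

lemma admits_one_product_dihedral_iff:
  assumes n: "n > 0" and C: "C \<subseteq> UNIV \<times> {..<n}"
  shows "admits_one_product (dihedral_group n) (dihedral_elem n ` C) k \<longleftrightarrow>
    (\<exists>cs. distinct cs \<and> set cs \<subseteq> C \<and> length cs = k \<and>
       (\<Prod>c\<in>set cs. code_sign c) = 1 \<and> int n dvd net_shift cs)"
proof -
  have inj: "inj_on (dihedral_elem n) C"
    using dihedral_elem_bij[OF n] C by (auto simp: bij_betw_def intro: inj_on_subset)
  have "admits_one_product (dihedral_group n) (dihedral_elem n ` C) k \<longleftrightarrow>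
    (\<exists>xs. set xs \<subseteq> dihedral_elem n ` C \<and> distinct xs \<and> length xs = k \<and>
      foldr (\<otimes>\<^bsub>dihedral_group n\<^esub>) xs \<one>\<^bsub>dihedral_group n\<^esub> = \<one>\<^bsub>dihedral_group n\<^esub>)"
    unfolding admits_one_product_def by (auto simp: distinct_card)
  also have "\<dots> \<longleftrightarrow> (\<exists>cs. set cs \<subseteq> C \<and> distinct cs \<and> length cs = k \<and>
      foldr (\<otimes>\<^bsub>dihedral_group n\<^esub>) (map (dihedral_elem n) cs) \<one>\<^bsub>dihedral_group n\<^esub>
        = \<one>\<^bsub>dihedral_group n\<^esub>)" (is "?L \<longleftrightarrow> ?R")
  proof
    assume ?L
    then obtain xs where xs: "set xs \<subseteq> dihedral_elem n ` C" "distinct xs" "length xs = k"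
      "foldr (\<otimes>\<^bsub>dihedral_group n\<^esub>) xs \<one>\<^bsub>dihedral_group n\<^esub> = \<one>\<^bsub>dihedral_group n\<^esub>" by blast
    then have "xs \<in> lists (dihedral_elem n ` C)" by auto
    then obtain cs where "cs \<in> lists C" "xs = map (dihedral_elem n) cs"
      unfolding lists_image by blast
    then show ?R using xs by (intro exI[of _ cs]) (auto simp: distinct_map)
  next
    assume ?R
    then obtain cs where cs: "set cs \<subseteq> C" "distinct cs" "length cs = k"
      "foldr (\<otimes>\<^bsub>dihedral_group n\<^esub>) (map (dihedral_elem n) cs) \<one>\<^bsub>dihedral_group n\<^esub>
        = \<one>\<^bsub>dihedral_group n\<^esub>" by blast
    then show ?L
      using inj_on_subset[OF inj cs(1)]
      by (intro exI[of _ "map (dihedral_elem n) cs"]) (auto simp: distinct_map)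
  qed
  also have "\<dots> \<longleftrightarrow> (\<exists>cs. distinct cs \<and> set cs \<subseteq> C \<and> length cs = k \<and>
       (\<Prod>c\<in>set cs. code_sign c) = 1 \<and> int n dvd net_shift cs)"
    unfolding foldr_dihedral_elem_eq_one_iff[OF n]
    using prod.distinct_set_conv_list[of _ code_sign] by (intro ex_cong1) auto
  finally show ?thesis .
qed

text \<open>Odd exponents fail on the reflections, which are involutions, and \<open>y\<close> has order \<open>n\<close>.\<close>

lemma dihedral_power_trivial_iff:
  assumes n: "n > 0"
  shows "(\<forall>g\<in>carrier (dihedral_group n). g [^]\<^bsub>dihedral_group n\<^esub> k = \<one>\<^bsub>dihedral_group n\<^esub>)
    \<longleftrightarrow> even k \<and> n dvd k"
proof -
  let ?cl = "\<lambda>u. {w. word_eq (dihedral_relators n) u w}"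
  define pw where "pw u k = ((\<lambda>w. w @ u) ^^ k) []" for u :: "dihedral_gen word" and k :: nat
  have pow: "?cl u [^]\<^bsub>dihedral_group n\<^esub> k = ?cl (pw u k)" for u k
    by (induction k)
      (simp_all add: dihedral_group_def pw_def nat_pow_def one_presented_group mult_presented_group)
  have sgn: "sgn_part (pw u k) = sgn_part u ^ k" for u k
    by (induction k) (simp_all add: pw_def sgn_part_append)
  have sgn_cases: "sgn_part u = 1 \<or> sgn_part u = - 1" for u
    by (induction u rule: sgn_part.induct) auto
  have shift1: "shift_part (pw u k) = int k * shift_part u" if "sgn_part u = 1" for u k
    using that sgn[of u]
    by (induction k) (simp_all add: pw_def shift_part_append algebra_simps)
  have shift2: "shift_part (pw u k) = (if even k then 0 else shift_part u)" if "sgn_part u = - 1" for u k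
    using that sgn[of u]
    by (induction k) (simp_all add: pw_def shift_part_append)
  have triv: "?cl u [^]\<^bsub>dihedral_group n\<^esub> k = \<one>\<^bsub>dihedral_group n\<^esub> \<longleftrightarrow>
      sgn_part u ^ k = 1 \<and> int n dvd shift_part (pw u k)" for u
  proof -
    have "?cl u [^]\<^bsub>dihedral_group n\<^esub> k = \<one>\<^bsub>dihedral_group n\<^esub> \<longleftrightarrow> ?cl (pw u k) = ?cl []"
      unfolding pow by (simp add: dihedral_group_def one_presented_group)
    then show ?thesis
      by (simp only: dihedral_class_eq_iff[OF n] sgn) simp
  qed
  have "(\<forall>g\<in>carrier (dihedral_group n). g [^]\<^bsub>dihedral_group n\<^esub> k = \<one>\<^bsub>dihedral_group n\<^esub>)
    \<longleftrightarrow> (\<forall>u. sgn_part u ^ k = 1 \<and> int n dvd shift_part (pw u k))"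
    using triv by (simp add: dihedral_group_def carrier_presented_group)
  also have "\<dots> \<longleftrightarrow> even k \<and> n dvd k"
  proof
    assume all: "\<forall>u. sgn_part u ^ k = 1 \<and> int n dvd shift_part (pw u k)"
    have "(- 1 :: int) ^ k = 1" using all[rule_format, of "[(gen_x, True)]"] by simp
    then have "even k" by (cases "even k") auto
    moreover have "int n dvd int k"
      using all[rule_format, of "[(gen_y, True)]"] by (simp add: shift1)
    ultimately show "even k \<and> n dvd k" by simp
  next
    assume k: "even k \<and> n dvd k"
    show "\<forall>u. sgn_part u ^ k = 1 \<and> int n dvd shift_part (pw u k)"
    proof
      fix u
      show "sgn_part u ^ k = 1 \<and> int n dvd shift_part (pw u k)"
        using sgn_cases[of u] k by (auto simp: shift1 shift2)
    qed
  qed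
  finally show ?thesis .
qed

lemma group_exp_dihedral:
  assumes n: "n > 0"
  shows "group_exp (dihedral_group n) = (if even n then n else 2 * n)"
  unfolding group_exp_def dihedral_power_trivial_iff[OF n]
proof (rule Least_equality)
  fix k assume k: "0 < k \<and> even k \<and> n dvd k"
  show "(if even n then n else 2 * n) \<le> k"
  proof (cases "even n")
    case False
    then have "2 * n dvd k" using k by (intro divides_mult) auto
    then show ?thesis using k False by (simp add: dvd_imp_le)
  qed (use k in \<open>simp add: dvd_imp_le\<close>)
qed (use n in auto)

lemma net_shift_append:
  "net_shift (cs @ ds) = (\<Prod>c\<leftarrow>cs. code_sign c) * net_shift ds + net_shift cs"
  by (induction cs rule: net_shift.induct) (simp_all add: code_sign_def)

lemma rotations_shift:
  "(\<Prod>c\<leftarrow>map (Pair False) ps. code_sign c) = 1"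
  "net_shift (map (Pair False) ps) = int (sum_list ps)"
  by (induction ps) (simp_all add: code_sign_def)

text \<open>One pair of reflections encloses the rotations in \<open>N\<close>, which inverts them; the other rotations
  are placed in front, and the remaining pairs follow one after the other.\<close>

lemma arrangement_exists:
  fixes u v :: "nat \<Rightarrow> nat"
  assumes P: "finite P" "N \<subseteq> P" and b: "1 \<le> b"
  shows "\<exists>cs. set cs = Pair False ` P \<union> Pair True ` (u ` {..<b} \<union> v ` {..<b})
    \<and> length cs = card P + 2 * b \<and> (\<Prod>c\<leftarrow>cs. code_sign c) = 1
    \<and> net_shift cs = (\<Sum>p\<in>P - N. int p) - (\<Sum>p\<in>N. int p) + (\<Sum>i<b. int (v i) - int (u i))"
proof -
  define rot where "rot A = map (Pair False) (sorted_list_of_set A)" for A :: "nat set"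
  define pairs where "pairs is = concat (map (\<lambda>i. [(True, u i), (True, v i)]) is)" for "is"
  have finN: "finite N" using P finite_subset by blast
  have rot: "set (rot A) = Pair False ` A" "length (rot A) = card A"
      "(\<Prod>c\<leftarrow>rot A. code_sign c) = 1" "net_shift (rot A) = (\<Sum>p\<in>A. int p)" if "finite A" for A
    using that sum_list_distinct_conv_sum_set[of "sorted_list_of_set A" "\<lambda>a. a"]
    by (auto simp: rot_def rotations_shift simp del: map_map)
  have pairs: "set (pairs is) = Pair True ` (u ` set is \<union> v ` set is)" "length (pairs is) = 2 * length is"
      "(\<Prod>c\<leftarrow>pairs is. code_sign c) = 1" "net_shift (pairs is) = (\<Sum>i\<leftarrow>is. int (v i) - int (u i))" for "is"
    by (induction "is") (auto simp: pairs_def code_sign_def)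
  define cs where "cs = rot (P - N) @ [(True, u 0)] @ rot N @ [(True, v 0)] @ pairs [1..<b]"
  have split0: "{..<b} = insert 0 {1..<b}" using b by auto
  have "set cs = Pair False ` P \<union> Pair True ` (u ` {..<b} \<union> v ` {..<b})"
    using P finN by (auto simp: cs_def rot pairs split0)
  moreover have "length cs = card P + 2 * b"
    using P finN b card_mono[OF P] by (simp add: cs_def rot pairs card_Diff_subset)
  moreover have "(\<Prod>c\<leftarrow>cs. code_sign c) = 1"
    using P finN by (simp add: cs_def rot pairs) (simp add: code_sign_def)
  moreover have "net_shift cs = (\<Sum>p\<in>P - N. int p) - (\<Sum>p\<in>N. int p) + (\<Sum>i<b. int (v i) - int (u i))"
    using P finN by (simp add: cs_def net_shift_append rot pairs split0 sum_list_distinct_conv_sum_set)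
  ultimately show ?thesis by blast
qed

section \<open>The Harborth constant\<close>

lemma harborth_property_dihedral_iff:
  assumes n: "n > 0"
  shows "harborth_property (dihedral_group n) k \<longleftrightarrow>
    (\<forall>C\<subseteq>UNIV \<times> {..<n}. card C = k \<longrightarrow> (\<exists>cs. distinct cs \<and> set cs \<subseteq> C
      \<and> length cs = (if even n then n else 2 * n)
      \<and> (\<Prod>c\<in>set cs. code_sign c) = 1 \<and> int n dvd net_shift cs))"
proof -
  let ?U = "UNIV \<times> {..<n} :: (bool \<times> nat) set"
  have inj: "inj_on (dihedral_elem n) ?U" and im: "dihedral_elem n ` ?U = carrier (dihedral_group n)"
    using dihedral_elem_bij[OF n] by (auto simp: bij_betw_def)
  have card: "card (dihedral_elem n ` C) = card C" if "C \<subseteq> ?U" for C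
    using inj_on_subset[OF inj that] by (rule card_image)
  have "harborth_property (dihedral_group n) k \<longleftrightarrow> (\<forall>C\<subseteq>?U. card C = k \<longrightarrow>
      admits_one_product (dihedral_group n) (dihedral_elem n ` C) (if even n then n else 2 * n))"
    unfolding harborth_property_def group_exp_dihedral[OF n] im[symmetric] all_subset_image
    using card by auto
  then show ?thesis using admits_one_product_dihedral_iff[OF n] by simp
qed

text \<open>The upper bound for even \<open>n\<close>. The pairs from lemma \<open>balanced_signed_sum\<close> are reduced modulo
  \<open>2 * m\<close> before they are arranged, since one exponent may have been shifted by a full turn.\<close>

lemma one_product_in_large_set:
  assumes m: "2 \<le> m" and C: "C \<subseteq> UNIV \<times> {..<2 * m}" and cardC: "card C = 2 * m + 2"
  shows "\<exists>cs. distinct cs \<and> set cs \<subseteq> C \<and> length cs = 2 * m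
    \<and> (\<Prod>c\<in>set cs. code_sign c) = 1 \<and> int (2 * m) dvd net_shift cs"
proof -
  define P where "P = {p. (False, p) \<in> C}"
  define Q where "Q = {q. (True, q) \<in> C}"
  have PQ: "P \<subseteq> {..<2 * m}" "Q \<subseteq> {..<2 * m}" using C by (auto simp: P_def Q_def)
  then have fin: "finite P" "finite Q" using finite_subset by blast+
  have "C = Pair False ` P \<union> Pair True ` Q"
  proof (rule Set.set_eqI)
    fix c show "c \<in> C \<longleftrightarrow> c \<in> Pair False ` P \<union> Pair True ` Q"
      by (cases c; cases "fst c") (auto simp: P_def Q_def)
  qed
  moreover have "card (Pair False ` P \<union> Pair True ` Q) = card P + card Q"
    using fin by (subst card_Un_disjoint) (auto simp: card_image inj_on_def)
  ultimately have cardPQ: "card P + card Q = 2 * m + 2" using cardC by simp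
  note cls = card_parity_classes[OF PQ(1)] card_parity_classes[OF PQ(2)]
  obtain pe po qe qo where *: "pe \<le> card {a \<in> P. even a}" "po \<le> card {a \<in> P. odd a}"
      "qe \<le> card {a \<in> Q. even a}" "qo \<le> card {a \<in> Q. odd a}"
      "pe + po + qe + qo = 2 * m" "even (qe + qo)" "2 \<le> qe + qo" "even (po + qo)"
      "0 < po \<or> 0 < qe \<and> 0 < qo"
    using deletion_counts[OF m cls(1,2) cls(4,5)] cls(3,6) cardPQ by auto
  obtain P' where P': "P' \<subseteq> P" "card P' = pe + po" "even (\<Sum>P') \<longleftrightarrow> even po" "0 < po \<Longrightarrow> \<exists>a\<in>P'. odd a"
    using subset_with_parity_counts[OF fin(1) *(1,2)] by metis
  obtain Q' where Q': "Q' \<subseteq> Q" "card Q' = qe + qo" "even (\<Sum>Q') \<longleftrightarrow> even qo"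
      "0 < qe \<Longrightarrow> \<exists>a\<in>Q'. even a" "0 < qo \<Longrightarrow> \<exists>a\<in>Q'. odd a"
    using subset_with_parity_counts[OF fin(2) *(3,4)] by metis
  obtain b where b: "card Q' = 2 * b" "1 \<le> b" using * Q'(2) by (elim evenE) auto
  obtain N u v where Nuv: "N \<subseteq> P'"
    "(\<lambda>i. u i mod (2 * m)) ` {..<b} \<union> (\<lambda>i. v i mod (2 * m)) ` {..<b} = Q'"
    "int (2 * m) dvd (\<Sum>p\<in>P' - N. int p) - (\<Sum>p\<in>N. int p) + (\<Sum>i<b. int (v i) - int (u i))"
  proof (rule balanced_signed_sum[of P' m Q' b])
    show "even (\<Sum>P' + \<Sum>Q')" using P'(3) Q'(3) *(8) by simp
    show "(\<exists>p\<in>P'. odd p) \<or> (\<exists>q\<in>Q'. even q) \<and> (\<exists>q\<in>Q'. odd q)"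
      using P'(4) Q'(4,5) *(9) by blast
  qed (use PQ P' Q' * b in auto)
  have finP': "finite P'" using P'(1) fin finite_subset by blast
  obtain cs where cs: "set cs = Pair False ` P' \<union> Pair True ` Q'" "length cs = card P' + 2 * b"
      "(\<Prod>c\<leftarrow>cs. code_sign c) = 1"
      "net_shift cs = (\<Sum>p\<in>P' - N. int p) - (\<Sum>p\<in>N. int p) +
         (\<Sum>i<b. int (v i mod (2 * m)) - int (u i mod (2 * m)))"
    using arrangement_exists[OF finP' Nuv(1) b(2), of "\<lambda>i. u i mod (2 * m)" "\<lambda>i. v i mod (2 * m)"]
    unfolding Nuv(2) by blast
  have "card (set cs) = card P' + card Q'"
    unfolding cs(1) using finite_subset[OF Q'(1) fin(2)] finP'
    by (subst card_Un_disjoint) (auto simp: card_image inj_on_def)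
  then have dist: "distinct cs" using cs(2) b by (intro card_distinct) simp
  have len: "length cs = 2 * m" using cs(2) b P'(2) Q'(2) *(5) by simp
  have sub: "set cs \<subseteq> C" unfolding cs(1) using P'(1) Q'(1) by (auto simp: P_def Q_def)
  have sign: "(\<Prod>c\<in>set cs. code_sign c) = 1"
    using cs(3) dist by (simp add: prod.distinct_set_conv_list)
  have mod: "int (2 * m) dvd int a - int (a mod (2 * m))" for a
    by (simp add: zmod_int mod_eq_dvd_iff[symmetric])
  have "int (2 * m) dvd (\<Sum>i<b. (int (v i) - int (v i mod (2 * m))) - (int (u i) - int (u i mod (2 * m))))"
    by (intro dvd_sum dvd_diff mod)
  from dvd_diff[OF Nuv(3) this] have "int (2 * m) dvd net_shift cs"
    unfolding cs(4) by (simp add: sum_subtractf sum.distrib algebra_simps)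
  then show ?thesis using dist len sub sign by blast
qed

text \<open>With the reflection the product is a reflection; without it all rotations are needed, and their
  exponents add up to \<open>m * (2 * m - 1)\<close>, which is not divisible by \<open>2 * m\<close>.\<close>

lemma no_one_product_in_rotations_and_one_reflection:
  assumes m: "1 \<le> m" and C: "C \<subseteq> insert (True, 0) ({False} \<times> {..<2 * m})"
  shows "\<not> (\<exists>cs. distinct cs \<and> set cs \<subseteq> C \<and> length cs = 2 * m
    \<and> (\<Prod>c\<in>set cs. code_sign c) = 1 \<and> int (2 * m) dvd net_shift cs)"
proof
  assume "\<exists>cs. distinct cs \<and> set cs \<subseteq> C \<and> length cs = 2 * m
    \<and> (\<Prod>c\<in>set cs. code_sign c) = 1 \<and> int (2 * m) dvd net_shift cs"
  then obtain cs where cs: "distinct cs" "set cs \<subseteq> C" "length cs = 2 * m"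
    "(\<Prod>c\<in>set cs. code_sign c) = 1" "int (2 * m) dvd net_shift cs" by blast
  have rot: "set cs \<subseteq> insert (True, 0) (Pair False ` {..<2 * m})"
    using cs(2) C by auto
  show False
  proof (cases "(True, 0) \<in> set cs")
    case True
    have "(\<Prod>c\<in>set cs - {(True, 0)}. code_sign c) = 1"
      using rot by (intro prod.neutral ballI) (auto simp: code_sign_def)
    then have "(\<Prod>c\<in>set cs. code_sign c) = - 1"
      using True by (subst prod.remove[of _ "(True, 0)"]) (auto simp: code_sign_def)
    then show False using cs(4) by simp
  next
    case False
    have sub: "set cs \<subseteq> Pair False ` {..<2 * m}" using rot False by blast
    then have all: "set cs = Pair False ` {..<2 * m}"
      using cs(1,3) by (intro card_seteq) (auto simp: card_image inj_on_def distinct_card)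
    have "net_shift cs = int (sum_list (map snd cs))"
      using sub by (induction cs rule: net_shift.induct) auto
    also have "sum_list (map snd cs) = (\<Sum>c\<in>set cs. snd c)"
      using cs(1) by (rule sum_list_distinct_conv_sum_set)
    also have "\<dots> = \<Sum>{..<2 * m}"
      unfolding all by (simp add: sum.reindex inj_on_def)
    finally have "net_shift cs = int (\<Sum>{..<2 * m})" .
    then have dvd: "2 * m dvd \<Sum>{..<2 * m}"
      using cs(5) by (simp only: of_nat_dvd_iff)
    have "2 * (\<Sum>i<l. i) + l = l * l" for l :: nat
      by (induction l) auto
    from this[of "2 * m"] have "\<Sum>{..<2 * m} + m = 2 * m * m" by simp
    then have "2 * m dvd \<Sum>{..<2 * m} + m" by (metis dvd_triv_left)
    then have "2 * m dvd m" using dvd by (simp only: dvd_add_right_iff)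
    then show False using m by (auto dest: dvd_imp_le)
  qed
qed

lemma no_one_product_of_all:
  assumes "odd n"
  shows "\<not> (\<exists>cs. distinct cs \<and> set cs \<subseteq> UNIV \<times> {..<n} \<and> length cs = 2 * n
    \<and> (\<Prod>c\<in>set cs. code_sign c) = 1)"
proof
  assume "\<exists>cs. distinct cs \<and> set cs \<subseteq> UNIV \<times> {..<n} \<and> length cs = 2 * n
    \<and> (\<Prod>c\<in>set cs. code_sign c) = 1"
  then obtain cs where cs: "distinct cs" "set cs \<subseteq> UNIV \<times> {..<n}" "length cs = 2 * n"
    "(\<Prod>c\<in>set cs. code_sign c) = 1" by blast
  have "set cs = UNIV \<times> {..<n}"
    using cs by (intro card_seteq) (auto simp: card_cartesian_product distinct_card)
  then have "(\<Prod>s\<in>UNIV. \<Prod>a<n. code_sign (s, a)) = 1"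
    using cs(4) by (simp add: prod.cartesian_product)
  then show False using assms by (simp add: UNIV_bool code_sign_def)
qed

theorem theorem1:
  fixes n :: nat
  assumes "n \<ge> 3"
  shows "harborth (dihedral_group n) = (if even n then n + 2 else 2 * n + 1)"
proof (cases "even n")
  case False
  let ?U = "UNIV \<times> {..<n} :: (bool \<times> nat) set"
  have none: "\<not> harborth_property (dihedral_group n) k" if "k \<le> 2 * n" for k
  proof
    assume holds: "harborth_property (dihedral_group n) k"
    have "k \<le> card ?U" using that by (simp add: card_cartesian_product)
    then obtain C where "C \<subseteq> ?U" "card C = k" by (metis obtain_subset_with_card_n)
    then obtain cs where "distinct cs" "set cs \<subseteq> C" "length cs = 2 * n" "(\<Prod>c\<in>set cs. code_sign c) = 1"
      using holds harborth_property_dihedral_iff[of n k] False assms by auto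
    then show False using no_one_product_of_all[OF False] \<open>C \<subseteq> ?U\<close> by blast
  qed
  then show ?thesis
    using False assms by (auto simp: harborth_def order_dihedral_group)
next
  case True
  then obtain m where m: "n = 2 * m" "2 \<le> m" using assms by (auto elim!: evenE)
  have holds: "harborth_property (dihedral_group n) (n + 2)"
    using harborth_property_dihedral_iff[of n "n + 2"] one_product_in_large_set[OF m(2)] True assms
    by (simp add: m(1))
  have "\<not> harborth_property (dihedral_group n) k" if "k \<le> n + 1" for k
  proof
    assume prop_k: "harborth_property (dihedral_group n) k"
    let ?S = "insert (True, 0) ({False} \<times> {..<n}) :: (bool \<times> nat) set"
    have "k \<le> card ?S" using that by (simp add: card_cartesian_product)
    then obtain C where C: "C \<subseteq> ?S" "card C = k" by (metis obtain_subset_with_card_n)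
    have "C \<subseteq> UNIV \<times> {..<n}" using C(1) assms by auto
    then obtain cs where "distinct cs" "set cs \<subseteq> C" "length cs = n"
        "(\<Prod>c\<in>set cs. code_sign c) = 1" "int n dvd net_shift cs"
      using prop_k harborth_property_dihedral_iff[of n k] C(2) True assms by auto
    moreover have "1 \<le> m" using m by simp
    ultimately show False
      using no_one_product_in_rotations_and_one_reflection[of m C] C(1) unfolding m(1) by blast
  qed
  then have "(LEAST k. harborth_property (dihedral_group n) k) = n + 2"
    using holds by (intro Least_equality) (auto simp: not_le[symmetric] intro: ccontr)
  moreover have "n + 2 \<le> order (dihedral_group n)" using assms by (simp add: order_dihedral_group)
  ultimately show ?thesis using holds True by (auto simp: harborth_def)
qed

end
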